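(* Let $\dot{\mathbf{x}}=\mathbf{f}(\mathbf{x})+\sqrt{2\varepsilon}\,\boldsymbol{\sigma}\boldsymbol{\xi}$, with $\mathbf{x}\in\mathbb{R}^n$, $\boldsymbol{\xi}\in\mathbb{R}^m$, $\boldsymbol{\sigma}\in\mathbb{R}^{n\times m}$ a constant matrix and $\varepsilon>0$, be a stochastic dynamical system in a statistically stationary state with probability density $\rho(\mathbf{x})$, and let $\varphi(\mathbf{x})$ be a scalar function whose stationary expectation $\langle\varphi\rangle_\varepsilon$ exists. Let $\mathbf{D}=\boldsymbol{\sigma}\boldsymbol{\sigma}^T$. Suppose there exist (twice) differentiable functions $V_u,V_l:\mathbb{R}^n\to\mathbb{R}$ and constants $U,L\in\mathbb{R}$ such that $$\varepsilon\nabla\cdot(\mathbf{D}\nabla V_u)+\mathbf{f}\cdot\nabla V_u+\varphi-U\le 0\quad\forall\,\mathbf{x}\in\mathbb{R}^n,$$ $$\varepsilon\nabla\cdot(\mathbf{D}\nabla V_l)+\mathbf{f}\cdot\nabla V_l+\varphi-L\ge 0\quad\forall\,\mathbf{x}\in\mathbb{R}^n,$$ and suppose that $V=V_u$ and $V=V_l$ grow slowly enough at infinity that each satisfies $$\lim_{R\to\infty}\int_{|\mathbf{x}|=R}\left(\varepsilon\rho\,\mathbf{D}\nabla V-\varepsilon V\,\mathbf{D}\nabla\rho+\rho V\mathbf{f}\right)\cdot\boldsymbol{\nu}\,dS=0.$$ Then $$L\le\langle\varphi\rangle_\varepsilon\le U.$$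
   Context: Here $\boldsymbol{\xi}$ denotes the standard $m$-dimensional vector noise (the paper's "standard vector Wiener process"), the noise is additive, and random trajectories are assumed bounded almost surely as $t\to\infty$. The system is assumed to be in statistical equilibrium: the density $\rho\ge0$ of its trajectories decays at infinity and satisfies the stationary Fokker–Planck equation $$\nabla\cdot(\varepsilon\mathbf{D}\nabla\rho-\mathbf{f}\rho)=0,\qquad\int_{\mathbb{R}^n}\rho\,d\mathbf{x}=1,\qquad\mathbf{D}=\boldsymbol{\sigma}\boldsymbol{\sigma}^T.$$ The stationary expectation is $\langle g\rangle_\varepsilon:=\int_{\mathbb{R}^n}g(\mathbf{x})\rho(\mathbf{x})\,d\mathbf{x}$. In the surface integral, $\boldsymbol{\nu}$ is the outward unit normal to the sphere $|\mathbf{x}|=R$ and $dS$ is its surface element. The functions $\mathbf{f}$ and $\varphi$ are polynomials of the state variables throughout the paper's treatment of stochastic systems. *)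

theory Defs
  imports "HOL-Probability.Probability"
begin

definition gradient :: "(real^'n \<Rightarrow> real) \<Rightarrow> real^'n \<Rightarrow> real^'n" where
  "gradient g x = (\<chi> i. frechet_derivative g (at x) (axis i 1))"

definition divergence :: "(real^'n \<Rightarrow> real^'n) \<Rightarrow> real^'n \<Rightarrow> real" where
  "divergence F x = (\<Sum>i\<in>UNIV. frechet_derivative F (at x) (axis i 1) $ i)"

definition twice_differentiable :: "(real^'n \<Rightarrow> real) \<Rightarrow> bool" where
  "twice_differentiable g \<longleftrightarrow>
     (\<forall>x. g differentiable (at x)) \<and> (\<forall>x. gradient g differentiable (at x))"

text \<open>
  Surface measure on the sphere of radius \<open>R > 0\<close>: the area of a Borel set \<open>A\<close> of the sphere
  is \<open>n / R\<close> times the volume of the cone over \<open>A\<close> with apex \<open>0\<close> (lemma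
  \<open>emeasure_sphere_measure\<close>). In dimension one this is counting measure on the two points.
\<close>

definition sphere_measure :: "real \<Rightarrow> 'a::euclidean_space measure" where
  "sphere_measure R =
     distr (density lborel (\<lambda>x. ennreal (DIM('a) / R) * indicator (cball 0 R) x)) borel
       (\<lambda>x. (R / norm x) *\<^sub>R x)"

lemma sphere_measure_proj_measurable [measurable]:
  "(\<lambda>x::'a::euclidean_space. (R / norm x) *\<^sub>R x) \<in> borel_measurable borel"
  by measurable

lemma emeasure_sphere_measure:
  fixes A :: "'a::euclidean_space set"
  assumes R: "R > 0" and A: "A \<in> sets borel" "A \<subseteq> sphere 0 R"
  shows "emeasure (sphere_measure R) A =
    ennreal (DIM('a) / R) * emeasure lborel {t *\<^sub>R y |t y. 0 < t \<and> t \<le> 1 \<and> y \<in> A}"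
proof -
  let ?p = "\<lambda>x::'a. (R / norm x) *\<^sub>R x"
  have eq: "?p -` A \<inter> cball 0 R = {t *\<^sub>R y |t y. 0 < t \<and> t \<le> 1 \<and> y \<in> A}"
  proof (intro equalityI subsetI)
    fix x assume x: "x \<in> ?p -` A \<inter> cball 0 R"
    then have "norm (?p x) = R" using A by auto
    then have nz: "x \<noteq> 0" using R by auto
    then have "x = (norm x / R) *\<^sub>R ?p x" using R by simp
    moreover have "0 < norm x / R" "norm x / R \<le> 1" "?p x \<in> A"
      using x nz R by auto
    ultimately show "x \<in> {t *\<^sub>R y |t y. 0 < t \<and> t \<le> 1 \<and> y \<in> A}" by blast
  next
    fix x assume "x \<in> {t *\<^sub>R y |t y. 0 < t \<and> t \<le> 1 \<and> y \<in> A}"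
    then obtain t y where t: "x = t *\<^sub>R y" "0 < t" "t \<le> 1" "y \<in> A" by blast
    then have "norm y = R" using A by auto
    with t R show "x \<in> ?p -` A \<inter> cball 0 R"
      by (auto simp: mult_le_cancel_right1)
  qed
  have m: "?p -` A \<in> sets borel"
    using measurable_sets[OF sphere_measure_proj_measurable A(1)] by simp
  have "emeasure (sphere_measure R) A
      = (\<integral>\<^sup>+x. ennreal (DIM('a) / R) * indicator (?p -` A \<inter> cball 0 R) x \<partial>lborel)"
    unfolding sphere_measure_def using A m
    by (subst emeasure_distr, simp_all, subst emeasure_density)
      (auto simp: indicator_def intro!: nn_integral_cong)
  also have "\<dots> = ennreal (DIM('a) / R) * emeasure lborel (?p -` A \<inter> cball 0 R)"
    using m by (subst nn_integral_cmult_indicator) auto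
  finally show ?thesis unfolding eq .
qed

lemma emeasure_sphere_measure_total:
  assumes R: "R > 0"
  shows "emeasure (sphere_measure R :: 'a::euclidean_space measure) (sphere 0 R)
    = ennreal (DIM('a) * unit_ball_vol (DIM('a)) * R ^ (DIM('a) - 1))"
proof -
  let ?C = "{t *\<^sub>R y |t y::'a. 0 < t \<and> t \<le> 1 \<and> y \<in> sphere 0 R}"
  have C: "?C = cball 0 R - {0}"
  proof (intro equalityI subsetI)
    fix x :: 'a assume "x \<in> cball 0 R - {0}"
    then have "x = (norm x / R) *\<^sub>R ((R / norm x) *\<^sub>R x)" "0 < norm x / R" "norm x / R \<le> 1"
      "(R / norm x) *\<^sub>R x \<in> sphere 0 R"
      using R by auto
    then show "x \<in> ?C" by blast
  qed (use R in \<open>auto simp: mult_le_cancel_right1\<close>)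
  have "emeasure lborel ?C = ennreal (unit_ball_vol (DIM('a)) * R ^ DIM('a))"
    unfolding C using R by (subst emeasure_Diff) (auto simp: emeasure_cball)
  moreover have "R ^ DIM('a) = R * R ^ (DIM('a) - 1)"
    by (metis DIM_positive power_eq_if not_gr_zero)
  ultimately show ?thesis
    using R by (subst emeasure_sphere_measure) (auto simp: ennreal_mult[symmetric])
qed

definition sphere_flux :: "(real^'n \<Rightarrow> real^'n) \<Rightarrow> real \<Rightarrow> real" where
  "sphere_flux F R = (LINT x|sphere_measure R. F x \<bullet> (x /\<^sub>R R))"

definition standard_wiener :: "'w measure \<Rightarrow> (real \<Rightarrow> 'w \<Rightarrow> real^'m) \<Rightarrow> bool" where
  "standard_wiener M W \<longleftrightarrow>
     prob_space M \<and>
     (\<forall>t\<ge>0. W t \<in> borel_measurable M) \<and>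
     (AE \<omega> in M. W 0 \<omega> = 0 \<and> continuous_on {0..} (\<lambda>t. W t \<omega>)) \<and>
     (\<forall>s t. 0 \<le> s \<and> s < t \<longrightarrow>
        distributed M lborel (\<lambda>\<omega>. W t \<omega> - W s \<omega>)
          (\<lambda>x. ennreal (\<Prod>i\<in>UNIV. normal_density 0 (sqrt (t - s)) (x $ i)))) \<and>
     (\<forall>T. mono T \<and> 0 \<le> T 0 \<longrightarrow>
        prob_space.indep_vars M (\<lambda>_. borel)
          (\<lambda>k \<omega>. W (T (Suc k)) \<omega> - W (T k) \<omega>) (UNIV :: nat set))"

text \<open>
  Since the noise is additive, \<open>dX = f(X) dt + sqrt (2 \<epsilon>) \<sigma> dW\<close> needs no stochastic integral: it
  is a pathwise integral equation. The initial state is independent of the noise.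
\<close>

definition solves_sde ::
  "'w measure \<Rightarrow> (real^'n \<Rightarrow> real^'n) \<Rightarrow> real^'m^'n \<Rightarrow> real
     \<Rightarrow> (real \<Rightarrow> 'w \<Rightarrow> real^'m) \<Rightarrow> (real \<Rightarrow> 'w \<Rightarrow> real^'n) \<Rightarrow> bool" where
  "solves_sde M f \<sigma> \<epsilon> W X \<longleftrightarrow>
     (\<forall>t\<ge>0. X t \<in> borel_measurable M) \<and>
     prob_space.indep_set M
       {X 0 -` A \<inter> space M |A. A \<in> sets borel}
       {(\<lambda>\<omega>. restrict (\<lambda>t. W t \<omega>) {0..}) -` B \<inter> space M |B. B \<in> sets (Pi\<^sub>M {0..} (\<lambda>_. borel))} \<and>
     (AE \<omega> in M. continuous_on {0..} (\<lambda>t. X t \<omega>) \<and>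
        (\<forall>t\<ge>0. X t \<omega> =
           X 0 \<omega> + integral {0..t} (\<lambda>s. f (X s \<omega>)) + sqrt (2 * \<epsilon>) *\<^sub>R (\<sigma> *v W t \<omega>)))"

text \<open>
  Classical solutions of the stationary Fokker-Planck equation, with just the regularity that
  gives the gradient and the divergence a meaning (\<open>D\<close> may be singular, so \<open>\<rho>\<close> need not be twice
  differentiable in every direction).
\<close>

definition stationary_fokker_planck ::
  "(real^'n \<Rightarrow> real^'n) \<Rightarrow> real^'n^'n \<Rightarrow> real \<Rightarrow> (real^'n \<Rightarrow> real) \<Rightarrow> bool" where
  "stationary_fokker_planck f D \<epsilon> \<rho> \<longleftrightarrow>
     (let J = (\<lambda>x. \<epsilon> *\<^sub>R (D *v gradient \<rho> x) - \<rho> x *\<^sub>R f x) in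
      (\<forall>x. \<rho> differentiable (at x)) \<and> (\<forall>x. J differentiable (at x)) \<and>
      (\<forall>x. divergence J x = 0))"

definition stationary_expectation :: "(real^'n \<Rightarrow> real) \<Rightarrow> (real^'n \<Rightarrow> real) \<Rightarrow> real" where
  "stationary_expectation \<rho> g = (LINT x|lborel. g x * \<rho> x)"

definition no_boundary_flux ::
  "(real^'n \<Rightarrow> real^'n) \<Rightarrow> real^'n^'n \<Rightarrow> real \<Rightarrow> (real^'n \<Rightarrow> real) \<Rightarrow> (real^'n \<Rightarrow> real) \<Rightarrow> bool" where
  "no_boundary_flux f D \<epsilon> \<rho> V \<longleftrightarrow>
     ((\<lambda>R. sphere_flux (\<lambda>x. (\<epsilon> * \<rho> x) *\<^sub>R (D *v gradient V x)
                          - (\<epsilon> * V x) *\<^sub>R (D *v gradient \<rho> x)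
                          + (\<rho> x * V x) *\<^sub>R f x) R) \<longlongrightarrow> 0) at_top"

end

theory Submission
  imports Defs
begin

text \<open>
  Multiply the inequality for \<open>V\<close> by \<open>\<rho> \<ge> 0\<close> and integrate. The point is that the stationary
  Fokker-Planck equation makes \<open>\<rho> * (\<epsilon> div (D \<nabla>V) + f \<bullet> \<nabla>V)\<close> the divergence of the field
  \<open>G = \<epsilon> \<rho> D \<nabla>V - \<epsilon> V D \<nabla>\<rho> + \<rho> V f\<close> (lemma \<open>divergence_green_field\<close>), whose flux through
  large spheres vanishes in the limit. For \<open>V = Vu\<close> this gives \<open>div G \<le> \<rho> * (U - \<phi>)\<close>, whose
  integral \<open>U - stationary_expectation \<rho> \<phi>\<close> must therefore be nonnegative; for \<open>V = Vl\<close> the same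
  applies to \<open>- G\<close>.

  The analytic difficulty is the divergence theorem. The field \<open>G\<close> is differentiable at every
  point, but its derivative may be discontinuous and even fail to be integrable. What remains is
  the pointwise bound \<open>div G \<le> h\<close> with a continuous integrable \<open>h\<close>. For cubes, the one-sided
  divergence theorem follows by Goursat's repeated subdivision (lemma \<open>box_flux_le_integral\<close>);
  consequently \<open>0 \<le> \<integral>h\<close> when field and bound have compact support.

  The passage from cubes to spheres is made with a radial cutoff \<open>\<psi>\<close>. The field \<open>\<psi> G\<close> has compact
  support and divergence at most \<open>\<psi> h + \<nabla>\<psi> \<bullet> G\<close>. In polar coordinates (lemma \<open>integral_polar\<close>) the
  integral of \<open>\<nabla>\<psi> \<bullet> G\<close> is minus a weighted mean of the fluxes of \<open>G\<close> through the spheres of the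
  transition shell, so it tends to \<open>0\<close> as the shell moves to infinity. The result is lemma
  \<open>integral_nonneg_of_divergence_le_flux_vanishing\<close>.
\<close>

section \<open>The divergence theorem on cubes for differentiable fields\<close>

text \<open>
  A face integral is written as an integral over the whole box of a function frozen in the normal
  coordinate, divided by the side length. All fluxes thus become integrals over boxes of full
  dimension; \<open>set_coord y i c\<close> is the projection of \<open>y\<close> to the hyperplane where coordinate
  \<open>i\<close> equals \<open>c\<close>.
\<close>

definition set_coord :: "'a::euclidean_space \<Rightarrow> 'a \<Rightarrow> real \<Rightarrow> 'a" where
  "set_coord y i c = y + (c - y \<bullet> i) *\<^sub>R i"

lemma inner_set_coord:
  assumes "i \<in> Basis" "k \<in> Basis"
  shows "set_coord y i c \<bullet> k = (if k = i then c else y \<bullet> k)"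
  using assms by (auto simp: set_coord_def inner_add_left inner_Basis)

lemma set_coord_translate:
  assumes "i \<in> Basis"
  shows "set_coord (y + t *\<^sub>R i) i c = set_coord y i c"
  using assms by (simp add: set_coord_def inner_add_left algebra_simps)

lemma continuous_on_set_coord [continuous_intros]:
  "continuous_on S (\<lambda>y. set_coord y i c)"
  unfolding set_coord_def by (intro continuous_intros)

lemma continuous_on_comp_set_coord:
  assumes "continuous_on UNIV F"
  shows "continuous_on S (\<lambda>y. F (set_coord y i c))"
  by (rule continuous_on_compose2[OF assms]) (auto intro: continuous_intros)

text \<open>
  The outward flux of \<open>F\<close> through the boundary of the box: the two faces orthogonal to \<open>i\<close>
  contribute the difference of the integrals of the normal component over them.
\<close>

definition box_flux :: "('a::euclidean_space \<Rightarrow> 'a) \<Rightarrow> 'a \<Rightarrow> 'a \<Rightarrow> real" where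
  "box_flux F a b = (\<Sum>i\<in>Basis. 1 / ((b - a) \<bullet> i) *
     integral (cbox a b) (\<lambda>y. (F (set_coord y i (b \<bullet> i)) - F (set_coord y i (a \<bullet> i))) \<bullet> i))"

abbreviation "mid j a b \<equiv> (a \<bullet> j + b \<bullet> j) / 2"

lemma integral_bisect:
  fixes g :: "'a::euclidean_space \<Rightarrow> real"
  assumes g: "continuous_on UNIV g" and j: "j \<in> Basis" and ab: "a \<bullet> j \<le> b \<bullet> j"
  shows "integral (cbox a b) g = integral (cbox a (set_coord b j (mid j a b))) g
     + integral (cbox (set_coord a j (mid j a b)) b) g"
proof -
  have "g integrable_on cbox a b"
    by (intro integrable_continuous continuous_on_subset[OF g]) auto
  moreover have "cbox a b \<inter> {x. x \<bullet> j \<le> mid j a b} = cbox a (set_coord b j (mid j a b))"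
  proof (intro set_eqI iffI)
    fix x assume x: "x \<in> cbox a b \<inter> {x. x \<bullet> j \<le> mid j a b}"
    then show "x \<in> cbox a (set_coord b j (mid j a b))"
      using j by (auto simp: mem_box inner_set_coord)
  next
    fix x assume x: "x \<in> cbox a (set_coord b j (mid j a b))"
    then have *: "x \<bullet> k \<le> (if k = j then mid j a b else b \<bullet> k)" "a \<bullet> k \<le> x \<bullet> k"
      if "k \<in> Basis" for k
      using that j by (auto simp: mem_box inner_set_coord)
    have "x \<bullet> k \<le> b \<bullet> k" if "k \<in> Basis" for k
      using *(1)[OF that] ab by (cases "k = j") auto
    with * *(1)[OF j] show "x \<in> cbox a b \<inter> {x. x \<bullet> j \<le> mid j a b}"
      by (auto simp: mem_box)
  qed
  moreover have "cbox a b \<inter> {x. x \<bullet> j \<ge> mid j a b} = cbox (set_coord a j (mid j a b)) b"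
  proof (intro set_eqI iffI)
    fix x assume x: "x \<in> cbox a b \<inter> {x. x \<bullet> j \<ge> mid j a b}"
    then show "x \<in> cbox (set_coord a j (mid j a b)) b"
      using j by (auto simp: mem_box inner_set_coord)
  next
    fix x assume x: "x \<in> cbox (set_coord a j (mid j a b)) b"
    then have *: "(if k = j then mid j a b else a \<bullet> k) \<le> x \<bullet> k" "x \<bullet> k \<le> b \<bullet> k"
      if "k \<in> Basis" for k
      using that j by (auto simp: mem_box inner_set_coord)
    have "a \<bullet> k \<le> x \<bullet> k" if "k \<in> Basis" for k
      using *(1)[OF that] ab by (cases "k = j") auto
    with * *(1)[OF j] show "x \<in> cbox a b \<inter> {x. x \<bullet> j \<ge> mid j a b}"
      by (auto simp: mem_box)
  qed
  ultimately show ?thesis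
    using integral_split[of g a b j "mid j a b"] j by simp
qed

text \<open>
  Translation along \<open>j\<close> carries one half of the box to the other and does not change \<open>g\<close>.
\<close>

lemma integral_half_box:
  fixes g :: "'a::euclidean_space \<Rightarrow> real"
  assumes g: "continuous_on UNIV g" and j: "j \<in> Basis" and ab: "a \<bullet> j \<le> b \<bullet> j"
    and indep: "\<And>y t. g (y + t *\<^sub>R j) = g y"
  shows "integral (cbox a (set_coord b j (mid j a b))) g = integral (cbox a b) g / 2"
    and "integral (cbox (set_coord a j (mid j a b)) b) g = integral (cbox a b) g / 2"
proof -
  let ?c = "((b \<bullet> j - a \<bullet> j) / 2) *\<^sub>R j"
  have 1: "set_coord a j (mid j a b) - ?c = a" "b - ?c = set_coord b j (mid j a b)"
    by (auto simp: set_coord_def algebra_simps diff_divide_distrib add_divide_distrib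
        simp flip: scaleR_add_left)
  have "integral (cbox a (set_coord b j (mid j a b))) g
      = integral (cbox (set_coord a j (mid j a b)) b) g"
    using integral_shift_cbox[of "set_coord a j (mid j a b)" ?c b g] unfolding 1 indep .
  with integral_bisect[OF g j ab]
  show "integral (cbox a (set_coord b j (mid j a b))) g = integral (cbox a b) g / 2"
    "integral (cbox (set_coord a j (mid j a b)) b) g = integral (cbox a b) g / 2"
    by linarith+
qed

text \<open>
  In directions other than \<open>j\<close> the faces are cut in two. In direction \<open>j\<close> the new common face
  occurs once with each orientation and cancels.
\<close>

lemma box_flux_bisect:
  fixes F :: "'a::euclidean_space \<Rightarrow> 'a"
  assumes F: "continuous_on UNIV F" and j: "j \<in> Basis" and ab: "a \<bullet> j < b \<bullet> j"
  shows "box_flux F a b = box_flux F a (set_coord b j (mid j a b))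
     + box_flux F (set_coord a j (mid j a b)) b"
  unfolding box_flux_def sum.distrib[symmetric]
proof (rule sum.cong[OF refl])
  fix i :: 'a assume i: "i \<in> Basis"
  let ?b = "set_coord b j (mid j a b)" and ?a = "set_coord a j (mid j a b)"
  let ?g = "\<lambda>p q y. (F (set_coord y i q) - F (set_coord y i p)) \<bullet> i"
  have cont: "continuous_on UNIV (\<lambda>y. F (set_coord y i p) \<bullet> i)" for p
    by (intro continuous_intros continuous_on_comp_set_coord F)
  have contg: "continuous_on UNIV (?g p q)" for p q
    by (intro continuous_intros continuous_on_comp_set_coord F)
  show "1 / ((b - a) \<bullet> i) * integral (cbox a b) (?g (a \<bullet> i) (b \<bullet> i))
      = 1 / ((?b - a) \<bullet> i) * integral (cbox a ?b) (?g (a \<bullet> i) (?b \<bullet> i))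
      + 1 / ((b - ?a) \<bullet> i) * integral (cbox ?a b) (?g (?a \<bullet> i) (b \<bullet> i))"
  proof (cases "i = j")
    case False
    then have same: "?a \<bullet> i = a \<bullet> i" "?b \<bullet> i = b \<bullet> i"
      using i j by (auto simp: inner_set_coord)
    have "integral (cbox a b) (?g (a \<bullet> i) (b \<bullet> i))
        = integral (cbox a ?b) (?g (a \<bullet> i) (b \<bullet> i)) + integral (cbox ?a b) (?g (a \<bullet> i) (b \<bullet> i))"
      using ab by (intro integral_bisect contg j) simp
    then show ?thesis
      unfolding inner_diff_left[of b a] inner_diff_left[of ?b a] inner_diff_left[of b ?a] same
      by (simp only: distrib_left)
  next
    case True
    define I where "I p = integral (cbox a b) (\<lambda>y. F (set_coord y j p) \<bullet> j)" for p
    have int: "(\<lambda>y. F (set_coord y j p) \<bullet> j) integrable_on cbox u v" for p u v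
      using cont[of p] True by (auto intro!: integrable_continuous intro: continuous_on_subset)
    have full: "integral (cbox a b) (?g p q) = I q - I p" for p q
      unfolding I_def True inner_diff_left by (intro integral_diff int)
    have half: "integral (cbox a ?b) (?g p q) = (I q - I p) / 2"
      "integral (cbox ?a b) (?g p q) = (I q - I p) / 2" for p q
      using ab j unfolding full[symmetric]
      by (intro integral_half_box contg j; simp add: True set_coord_translate)+
    have sides: "(?b - a) \<bullet> i = (b - a) \<bullet> i / 2" "(b - ?a) \<bullet> i = (b - a) \<bullet> i / 2"
      "?b \<bullet> i = mid j a b" "?a \<bullet> i = mid j a b"
      using j by (auto simp: True inner_diff_left inner_set_coord field_simps)
    have "(b - a) \<bullet> i > 0" using ab by (simp add: True inner_diff_left)
    then show ?thesis unfolding sides half full by (simp add: field_simps)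
  qed
qed

text \<open>
  The amount by which the divergence theorem, read as an upper bound, fails on a box. It is
  additive under bisection, so a failure is inherited, in proportion to the volume, by one of the
  two halves.
\<close>

definition flux_excess :: "('a::euclidean_space \<Rightarrow> 'a) \<Rightarrow> ('a \<Rightarrow> real) \<Rightarrow> 'a \<Rightarrow> 'a \<Rightarrow> real" where
  "flux_excess F h a b = box_flux F a b - integral (cbox a b) h"

lemma excess_halve_side:
  fixes F :: "'a::euclidean_space \<Rightarrow> 'a"
  assumes F: "continuous_on UNIV F" and h: "continuous_on UNIV h"
    and j: "j \<in> Basis" and ab: "a \<bullet> j < b \<bullet> j"
    and ex: "c * measure lborel (cbox a b) \<le> flux_excess F h a b"
  obtains a' b' where "cbox a' b' \<subseteq> cbox a b"
    "\<And>k. k \<in> Basis \<Longrightarrow> (b' - a') \<bullet> k = (if k = j then (b - a) \<bullet> k / 2 else (b - a) \<bullet> k)"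
    "c * measure lborel (cbox a' b') \<le> flux_excess F h a' b'"
proof -
  let ?b = "set_coord b j (mid j a b)" and ?a = "set_coord a j (mid j a b)"
  have split: "flux_excess F h a b = flux_excess F h a ?b + flux_excess F h ?a b"
    unfolding flux_excess_def
    using box_flux_bisect[OF F j ab] integral_bisect[OF h j, of a b] ab by simp
  have half: "measure lborel (cbox a ?b) = measure lborel (cbox a b) / 2"
    "measure lborel (cbox ?a b) = measure lborel (cbox a b) / 2"
    using integral_half_box[of "\<lambda>_. 1" j a b] j ab by auto
  have "c * measure lborel (cbox a b) / 2 \<le> flux_excess F h a ?b
      \<or> c * measure lborel (cbox a b) / 2 \<le> flux_excess F h ?a b"
    using ex split by linarith
  then have "c * measure lborel (cbox a ?b) \<le> flux_excess F h a ?b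
      \<or> c * measure lborel (cbox ?a b) \<le> flux_excess F h ?a b"
    unfolding half by simp
  moreover have "cbox a ?b \<subseteq> cbox a b" "cbox ?a b \<subseteq> cbox a b"
    using j ab by (auto simp: subset_box inner_set_coord)
  moreover have "(?b - a) \<bullet> k = (if k = j then (b - a) \<bullet> k / 2 else (b - a) \<bullet> k)"
    "(b - ?a) \<bullet> k = (if k = j then (b - a) \<bullet> k / 2 else (b - a) \<bullet> k)" if "k \<in> Basis" for k
    using j that by (auto simp: inner_set_coord inner_diff_left field_simps)
  ultimately show ?thesis using that by metis
qed

text \<open>
  Bisecting in every direction returns to a cube. Keeping cubes, rather than arbitrary boxes,
  matters: the error estimate at a point of differentiability needs diameter and side length to be
  comparable.
\<close>

lemma excess_halve_cube:
  fixes F :: "'a::euclidean_space \<Rightarrow> 'a"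
  assumes F: "continuous_on UNIV F" and h: "continuous_on UNIV h"
    and s: "0 < s" and side: "\<And>k. k \<in> Basis \<Longrightarrow> (b - a) \<bullet> k = s"
    and ex: "c * measure lborel (cbox a b) \<le> flux_excess F h a b"
  obtains a' b' where "cbox a' b' \<subseteq> cbox a b" "\<And>k. k \<in> Basis \<Longrightarrow> (b' - a') \<bullet> k = s / 2"
    "c * measure lborel (cbox a' b') \<le> flux_excess F h a' b'"
proof -
  have "\<exists>a' b'. cbox a' b' \<subseteq> cbox a b \<and>
      (\<forall>k\<in>Basis. (b' - a') \<bullet> k = (if k \<in> J then s / 2 else s)) \<and>
      c * measure lborel (cbox a' b') \<le> flux_excess F h a' b'"
    if "finite J" "J \<subseteq> Basis" for J
    using that
  proof (induction J rule: finite_induct)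
    case empty
    with side ex show ?case by auto
  next
    case (insert j J)
    then obtain a' b' where *: "cbox a' b' \<subseteq> cbox a b"
      "\<forall>k\<in>Basis. (b' - a') \<bullet> k = (if k \<in> J then s / 2 else s)"
      "c * measure lborel (cbox a' b') \<le> flux_excess F h a' b'" by auto
    have "(b' - a') \<bullet> j = s" using *(2) insert by auto
    then have "a' \<bullet> j < b' \<bullet> j" using s by (simp add: inner_diff_left)
    from excess_halve_side[OF F h _ this *(3)] insert.prems
    obtain a'' b'' where "cbox a'' b'' \<subseteq> cbox a' b'"
      "\<And>k. k \<in> Basis \<Longrightarrow> (b'' - a'') \<bullet> k
         = (if k = j then (b' - a') \<bullet> k / 2 else (b' - a') \<bullet> k)"
      "c * measure lborel (cbox a'' b'') \<le> flux_excess F h a'' b''" by auto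
    with *(1,2) insert.hyps show ?case
      by (intro exI[of _ a''] exI[of _ b'']) auto
  qed
  from this[of Basis] that show ?thesis by auto
qed

lemma norm_diff_le_of_cube:
  fixes x y :: "'a::euclidean_space"
  assumes side: "\<And>k. k \<in> Basis \<Longrightarrow> (b - a) \<bullet> k = s" and "y \<in> cbox a b" "x \<in> cbox a b"
  shows "norm (y - x) \<le> real DIM('a) * s"
proof -
  have "norm (y - x) \<le> (\<Sum>k\<in>Basis. \<bar>(y - x) \<bullet> k\<bar>)" by (rule norm_le_l1)
  also have "\<dots> \<le> (\<Sum>k\<in>(Basis::'a set). s)"
  proof (rule sum_mono)
    fix k :: 'a assume k: "k \<in> Basis"
    then have "a \<bullet> k \<le> y \<bullet> k" "y \<bullet> k \<le> b \<bullet> k" "a \<bullet> k \<le> x \<bullet> k" "x \<bullet> k \<le> b \<bullet> k"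
      "b \<bullet> k - a \<bullet> k = s"
      using assms(2,3) side[OF k] by (auto simp: mem_box inner_diff_left)
    then show "\<bar>(y - x) \<bullet> k\<bar> \<le> s" by (simp add: inner_diff_left abs_le_iff)
  qed
  finally show ?thesis by simp
qed

text \<open>
  On a cube of side \<open>s\<close>, the linear part of \<open>F\<close> contributes exactly its trace times the volume.
  The remainder is at most \<open>\<eta>\<close> times the diameter, which is at most \<open>s * DIM('a)\<close>, at each of the
  \<open>2 * DIM('a)\<close> faces; division by \<open>s\<close> leaves an error proportional to \<open>\<eta>\<close>.
\<close>

lemma box_flux_differentiable_le:
  fixes F :: "'a::euclidean_space \<Rightarrow> 'a"
  assumes F: "continuous_on UNIV F" and s: "0 < s"
    and side: "\<And>k. k \<in> Basis \<Longrightarrow> (b - a) \<bullet> k = s" and x: "x \<in> cbox a b"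
    and lin: "linear F'"
    and approx: "\<And>y. y \<in> cbox a b \<Longrightarrow> norm (F y - F x - F' (y - x)) \<le> \<eta> * norm (y - x)"
    and \<eta>: "0 \<le> \<eta>"
  shows "box_flux F a b \<le>
    ((\<Sum>i\<in>Basis. F' i \<bullet> i) + 2 * \<eta> * real DIM('a) ^ 2) * measure lborel (cbox a b)"
proof -
  let ?n = "real DIM('a)"
  have "norm (y - x) \<le> ?n * s" if "y \<in> cbox a b" for y
    using norm_diff_le_of_cube[OF side that x] .
  then have approx': "norm (F y - F x - F' (y - x)) \<le> \<eta> * (?n * s)" if "y \<in> cbox a b" for y
    using approx[OF that] \<eta> that by (meson mult_left_mono order_trans)
  have "1 / ((b - a) \<bullet> i) *
      integral (cbox a b) (\<lambda>y. (F (set_coord y i (b \<bullet> i)) - F (set_coord y i (a \<bullet> i))) \<bullet> i)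
      \<le> (F' i \<bullet> i + 2 * \<eta> * ?n) * measure lborel (cbox a b)" if i: "i \<in> Basis" for i
  proof -
    let ?g = "\<lambda>y. (F (set_coord y i (b \<bullet> i)) - F (set_coord y i (a \<bullet> i))) \<bullet> i"
    have "?g y \<le> s * (F' i \<bullet> i + 2 * \<eta> * ?n)" if y: "y \<in> cbox a b" for y
    proof -
      let ?p = "set_coord y i (b \<bullet> i)" and ?q = "set_coord y i (a \<bullet> i)"
      have ab: "a \<bullet> i \<le> b \<bullet> i" using side[OF i] s by (simp add: inner_diff_left)
      have pq: "?p \<in> cbox a b" "?q \<in> cbox a b"
        using y i ab by (auto simp: mem_box inner_set_coord)
      have "?p - ?q = s *\<^sub>R i"
        using side[OF i] by (simp add: set_coord_def inner_diff_left flip: scaleR_diff_left)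
      then have "F' (?p - x) - F' (?q - x) = s *\<^sub>R F' i"
        using lin by (metis diff_diff_eq2 diff_add_cancel linear_diff linear_scale)
      then have "F ?p - F ?q
          = s *\<^sub>R F' i + ((F ?p - F x - F' (?p - x)) - (F ?q - F x - F' (?q - x)))"
        by (simp add: algebra_simps)
      then have "?g y = s * (F' i \<bullet> i)
          + ((F ?p - F x - F' (?p - x)) \<bullet> i - (F ?q - F x - F' (?q - x)) \<bullet> i)"
        by (metis inner_add_left inner_diff_left inner_scaleR_left)
      moreover have "\<bar>(F ?p - F x - F' (?p - x)) \<bullet> i\<bar> \<le> \<eta> * (?n * s)"
        "\<bar>(F ?q - F x - F' (?q - x)) \<bullet> i\<bar> \<le> \<eta> * (?n * s)"
        using pq Basis_le_norm[OF i] approx' order_trans by blast+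
      ultimately show ?thesis by (simp add: algebra_simps)
    qed
    then have "integral (cbox a b) ?g \<le> integral (cbox a b) (\<lambda>_. s * (F' i \<bullet> i + 2 * \<eta> * ?n))"
      by (intro integral_le integrable_continuous continuous_intros continuous_on_comp_set_coord F)
    then show ?thesis using s side[OF i] by (simp add: field_simps)
  qed
  then have "box_flux F a b \<le> (\<Sum>i\<in>Basis. (F' i \<bullet> i + 2 * \<eta> * ?n) * measure lborel (cbox a b))"
    unfolding box_flux_def by (rule sum_mono)
  also have "\<dots> = ((\<Sum>i\<in>Basis. F' i \<bullet> i) + 2 * \<eta> * ?n ^ 2) * measure lborel (cbox a b)"
    by (simp add: sum.distrib power2_eq_square flip: sum_distrib_right)
  finally show ?thesis .
qed

text \<open>
  The divergence theorem for a field that is merely differentiable, in one-sided form, by the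
  argument of Goursat. The derivative may fail to be integrable, so the fundamental theorem of
  calculus cannot be applied under an integral sign. Instead, a failure
  with excess \<open>c\<close> per unit volume is passed down to a nested sequence of cubes, and
  differentiability at their common point, together with the continuity of \<open>h\<close>, forces \<open>c \<le> 0\<close>.
\<close>

lemma box_flux_le_integral:
  fixes F :: "'a::euclidean_space \<Rightarrow> 'a"
  assumes F: "\<And>x. (F has_derivative F' x) (at x)"
    and div: "\<And>x. (\<Sum>i\<in>Basis. F' x i \<bullet> i) \<le> h x"
    and h: "continuous_on UNIV h"
    and s: "0 < s" and side: "\<And>k. k \<in> Basis \<Longrightarrow> (b - a) \<bullet> k = s"
  shows "box_flux F a b \<le> integral (cbox a b) h"
proof (rule ccontr)
  assume "\<not> ?thesis"
  then have pos: "flux_excess F h a b > 0" by (simp add: flux_excess_def)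
  have contF: "continuous_on UNIV F"
    using F has_derivative_continuous by (metis continuous_at_imp_continuous_on)
  have content_pos: "measure lborel (cbox u v) > 0"
    if "0 < r" "\<And>k. k \<in> Basis \<Longrightarrow> (v - u) \<bullet> k = r" for u v :: 'a and r
    unfolding content_pos_lt_eq
  proof
    fix k :: 'a assume "k \<in> Basis"
    with that(2)[of k] that(1) show "u \<bullet> k < v \<bullet> k" by (simp add: inner_diff_left)
  qed
  define c where "c = flux_excess F h a b / measure lborel (cbox a b)"
  have c: "c > 0" unfolding c_def using pos content_pos[OF s side] by simp
  have c0: "c * measure lborel (cbox a b) \<le> flux_excess F h a b"
    unfolding c_def using content_pos[OF s side] by simp
  define P where "P n p \<longleftrightarrow> (\<forall>k\<in>Basis. (snd p - fst p) \<bullet> k = s / 2 ^ n) \<and>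
      c * measure lborel (cbox (fst p) (snd p)) \<le> flux_excess F h (fst p) (snd p)"
    for n and p :: "'a \<times> 'a"
  have "\<exists>p. \<forall>n. P n (p n) \<and>
      cbox (fst (p (Suc n))) (snd (p (Suc n))) \<subseteq> cbox (fst (p n)) (snd (p n))"
  proof (rule dependent_nat_choice)
    show "\<exists>p. P 0 p" using side c0 by (intro exI[of _ "(a, b)"]) (auto simp: P_def)
  next
    fix p n assume "P n p"
    then have *: "\<And>k. k \<in> Basis \<Longrightarrow> (snd p - fst p) \<bullet> k = s / 2 ^ n"
      "c * measure lborel (cbox (fst p) (snd p)) \<le> flux_excess F h (fst p) (snd p)"
      by (auto simp: P_def)
    have "0 < s / 2 ^ n" using s by simp
    from excess_halve_cube[OF contF h this *] obtain a' b'
      where "cbox a' b' \<subseteq> cbox (fst p) (snd p)"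
        "\<And>k. k \<in> Basis \<Longrightarrow> (b' - a') \<bullet> k = s / 2 ^ n / 2"
        "c * measure lborel (cbox a' b') \<le> flux_excess F h a' b'" by auto
    then show "\<exists>q. P (Suc n) q \<and> cbox (fst q) (snd q) \<subseteq> cbox (fst p) (snd p)"
      by (intro exI[of _ "(a', b')"]) (auto simp: P_def)
  qed
  then obtain p where p: "\<And>n. P n (p n)"
    "\<And>n. cbox (fst (p (Suc n))) (snd (p (Suc n))) \<subseteq> cbox (fst (p n)) (snd (p n))" by auto
  define Q where "Q n = cbox (fst (p n)) (snd (p n))" for n
  have sideQ: "(snd (p n) - fst (p n)) \<bullet> k = s / 2 ^ n" if "k \<in> Basis" for n k
    using p(1)[of n] that by (auto simp: P_def)
  have posQ: "measure lborel (Q n) > 0" for n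
    unfolding Q_def by (rule content_pos[of "s / 2 ^ n"]) (use s sideQ in auto)
  have "\<Inter>(range Q) \<noteq> {}"
  proof (rule compact_nest)
    show "Q n \<subseteq> Q m" if "m \<le> n" for m n
      by (rule lift_Suc_antimono_le[OF _ that]) (unfold Q_def, rule p(2))
    show "Q n \<noteq> {}" for n using posQ[of n] by auto
  qed (auto simp: Q_def)
  then obtain x where x: "\<And>n. x \<in> Q n" by auto
  let ?N = "real DIM('a)"
  \<comment> \<open>The linearisation costs \<open>2 * \<eta> * ?N ^ 2\<close> per unit volume and the oscillation of \<open>h\<close> costs \<open>\<eta>\<close>.\<close>
  define \<eta> where "\<eta> = c / (2 * (2 * ?N ^ 2 + 1))"
  have \<eta>: "\<eta> > 0" unfolding \<eta>_def using c by (intro divide_pos_pos) (auto intro: add_nonneg_pos)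
  have \<eta>c: "\<eta> * (2 * ?N ^ 2 + 1) < c"
  proof -
    have "2 * ?N ^ 2 + 1 > 0" by (intro add_nonneg_pos) auto
    then have "\<eta> * (2 * ?N ^ 2 + 1) = c / 2" unfolding \<eta>_def by (simp add: field_simps)
    with c show ?thesis by simp
  qed
  obtain d1 where d1: "d1 > 0"
    "\<And>y. norm (y - x) < d1 \<Longrightarrow> norm (F y - F x - F' x (y - x)) \<le> \<eta> * norm (y - x)"
    using F[of x] \<eta> unfolding has_derivative_at_alt by blast
  have "continuous (at x) h" using h by (simp add: continuous_on_eq_continuous_at)
  then obtain d2 where d2: "d2 > 0" "\<And>y. dist y x < d2 \<Longrightarrow> dist (h y) (h x) < \<eta>"
    using \<eta> unfolding continuous_at_eps_delta by blast
  obtain n where n: "s * ?N / 2 ^ n < min d1 d2"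
  proof -
    have "(\<lambda>n. s * ?N / 2 ^ n) \<longlonglongrightarrow> 0"
      by (rule tendsto_divide_0[OF tendsto_const filterlim_realpow_sequentially_gt1]) simp
    then have "\<forall>\<^sub>F n in sequentially. s * ?N / 2 ^ n < min d1 d2"
      using d1 d2 by (intro order_tendstoD(2)) auto
    with that show ?thesis by (auto simp: eventually_sequentially)
  qed
  have near: "norm (y - x) < min d1 d2" if y: "y \<in> Q n" for y
  proof -
    have "norm (y - x) \<le> ?N * (s / 2 ^ n)"
      using norm_diff_le_of_cube[OF sideQ] y x[of n] unfolding Q_def by blast
    then show ?thesis using n by (simp add: mult.commute)
  qed
  have "box_flux F (fst (p n)) (snd (p n))
      \<le> ((\<Sum>i\<in>Basis. F' x i \<bullet> i) + 2 * \<eta> * ?N ^ 2) * measure lborel (Q n)"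
    unfolding Q_def
  proof (rule box_flux_differentiable_le[OF contF _ sideQ])
    show "linear (F' x)" using F[of x] by (simp add: has_derivative_linear)
    show "norm (F y - F x - F' x (y - x)) \<le> \<eta> * norm (y - x)"
      if "y \<in> cbox (fst (p n)) (snd (p n))" for y
      using near[of y] that d1(2) by (auto simp: Q_def)
  qed (use s \<eta> x in \<open>auto simp: Q_def\<close>)
  also have "\<dots> \<le> (h x + 2 * \<eta> * ?N ^ 2) * measure lborel (Q n)"
    using div[of x] posQ[of n] by (intro mult_right_mono) auto
  finally have 1: "box_flux F (fst (p n)) (snd (p n)) \<le> (h x + 2 * \<eta> * ?N ^ 2) * measure lborel (Q n)" .
  have "integral (Q n) (\<lambda>_. h x - \<eta>) \<le> integral (Q n) h"
    unfolding Q_def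
  proof (intro integral_le integrable_continuous continuous_on_subset[OF h])
    fix y assume "y \<in> cbox (fst (p n)) (snd (p n))"
    then have "dist y x < d2" using near[of y] by (auto simp: Q_def dist_norm)
    from d2(2)[OF this] show "h x - \<eta> \<le> h y" by (auto simp: dist_real_def)
  qed auto
  then have 2: "(h x - \<eta>) * measure lborel (Q n) \<le> integral (Q n) h"
    by (simp add: Q_def mult.commute)
  have "c * measure lborel (Q n) \<le> \<eta> * (2 * ?N ^ 2 + 1) * measure lborel (Q n)"
    using 1 2 p(1)[of n] by (simp add: P_def flux_excess_def Q_def algebra_simps)
  with posQ[of n] \<eta>c show False by simp
qed

lemma integrable_continuous_compact_support:
  fixes g :: "'a::euclidean_space \<Rightarrow> real"
  assumes g: "continuous_on UNIV g" and supp: "\<And>x. norm x \<ge> r \<Longrightarrow> g x = 0"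
  shows "integrable lborel g"
proof -
  have "integrable lborel (\<lambda>x. indicator (cball 0 r) x *\<^sub>R g x)"
    by (intro borel_integrable_compact compact_cball continuous_on_subset[OF g]) auto
  moreover have "(\<lambda>x. indicator (cball 0 r) x *\<^sub>R g x) = g"
    using supp by (auto simp: fun_eq_iff indicator_def)
  ultimately show ?thesis by simp
qed

text \<open>
  On a cube around the support, the boundary flux vanishes, which leaves the integral of \<open>h\<close>.
\<close>

lemma integral_nonneg_of_divergence_le:
  fixes F :: "'a::euclidean_space \<Rightarrow> 'a"
  assumes F: "\<And>x. (F has_derivative F' x) (at x)"
    and div: "\<And>x. (\<Sum>i\<in>Basis. F' x i \<bullet> i) \<le> h x"
    and h: "continuous_on UNIV h"
    and suppF: "\<And>x. norm x \<ge> r \<Longrightarrow> F x = 0" and supph: "\<And>x. norm x \<ge> r \<Longrightarrow> h x = 0"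
  shows "0 \<le> (LINT x|lborel. h x)"
proof -
  define q where "q = max r 1"
  define b :: 'a where "b = (\<Sum>i\<in>Basis. q *\<^sub>R i)"
  have b: "b \<bullet> k = q" if "k \<in> Basis" for k using that by (simp add: b_def)
  have far: "F y = 0" if "k \<in> Basis" "\<bar>y \<bullet> k\<bar> = q" for y k
    using Basis_le_norm[of k y] that suppF[of y] by (simp add: q_def)
  have "box_flux F (- b) b = 0"
    unfolding box_flux_def
  proof (intro sum.neutral ballI)
    fix i :: 'a assume i: "i \<in> Basis"
    have "F (set_coord y i (b \<bullet> i)) = 0" "F (set_coord y i (- b \<bullet> i)) = 0" for y
      using i by (auto intro!: far[OF i] simp: inner_set_coord b q_def)
    then show "1 / ((b - - b) \<bullet> i) * integral (cbox (- b) b)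
        (\<lambda>y. (F (set_coord y i (b \<bullet> i)) - F (set_coord y i (- b \<bullet> i))) \<bullet> i) = 0"
      by simp
  qed
  moreover have "box_flux F (- b) b \<le> integral (cbox (- b) b) h"
    by (rule box_flux_le_integral[OF F div h, of "2 * q"])
      (auto simp: q_def inner_add_left b)
  moreover have zero: "h x = 0" if "x \<notin> cbox (- b) b" for x
  proof -
    from that obtain k where "k \<in> Basis" "\<bar>x \<bullet> k\<bar> > q"
      by (auto simp: mem_box b)
    then show ?thesis using Basis_le_norm[of k x] supph[of x] by (simp add: q_def)
  qed
  have "(\<lambda>x. if x \<in> cbox (- b) b then h x else 0) = h" using zero by auto
  then have "integral (cbox (- b) b) h = integral UNIV h"
    using integral_restrict_UNIV[of "cbox (- b) b" h] by simp
  moreover have "integrable lborel h"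
    by (rule integrable_continuous_compact_support[OF h supph])
  then have "integral UNIV h = (LINT x|lborel. h x)" by (rule integral_lborel)
  ultimately show ?thesis by simp
qed

section \<open>Polar coordinates\<close>

lemma measurable_ball_indicator [measurable]:
  "(\<lambda>(r::real, x::'a::euclidean_space). indicator {x. norm x \<le> r} x :: real)
    \<in> borel_measurable (lborel \<Otimes>\<^sub>M lborel)"
  unfolding indicator_def by measurable

lemma nn_integral_lborel_scaleR:
  fixes H :: "'a::euclidean_space \<Rightarrow> ennreal"
  assumes [measurable]: "H \<in> borel_measurable borel" and c: "c \<noteq> 0"
  shows "(\<integral>\<^sup>+x. H x \<partial>lborel) = ennreal (\<bar>c\<bar> ^ DIM('a)) * (\<integral>\<^sup>+x. H (c *\<^sub>R x) \<partial>lborel)"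
  by (subst lborel_affine[OF c, of 0])
    (simp add: nn_integral_density nn_integral_distr nn_integral_cmult)

text \<open>
  Polar coordinates, for a sphere measure that is defined by cones over subsets of the sphere.
  The left-hand side is the iterated integral over spheres and radii, with the sphere measure
  unfolded. After exchanging the integrals, the substitution \<open>r = s * norm x\<close> turns the constraint
  \<open>norm x \<le> r\<close> into \<open>1 \<le> s\<close> and the integrand into \<open>n / s * H (s *\<^sub>R x)\<close>, where \<open>n\<close> is the dimension.
  After a second exchange, scaling of Lebesgue measure gives \<open>\<integral>H\<close> times the integral of
  \<open>n * s powr (- n - 1)\<close> over \<open>{1..}\<close>, which is \<open>1\<close>.
\<close>

lemma nn_integral_polar:
  fixes H :: "'a::euclidean_space \<Rightarrow> ennreal"
  assumes [measurable]: "H \<in> borel_measurable borel"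
  shows "(\<integral>\<^sup>+r. \<integral>\<^sup>+x. ennreal (indicator {0<..} r * (DIM('a) / r) * indicator {x. norm x \<le> r} x)
      * H ((r / norm x) *\<^sub>R x) \<partial>lborel \<partial>lborel) = (\<integral>\<^sup>+x. H x \<partial>lborel)"
proof -
  let ?n = "real DIM('a)"
  let ?w = "\<lambda>r x::'a. ennreal (indicator {0<..} r * (?n / r) * indicator {x. norm x \<le> r} x)"
  have "(\<integral>\<^sup>+r. \<integral>\<^sup>+x. ?w r x * H ((r / norm x) *\<^sub>R x) \<partial>lborel \<partial>lborel)
      = (\<integral>\<^sup>+x. \<integral>\<^sup>+r. ?w r x * H ((r / norm x) *\<^sub>R x) \<partial>lborel \<partial>lborel)"
    by (rule lborel_pair.Fubini') measurable
  also have "\<dots> = (\<integral>\<^sup>+x. \<integral>\<^sup>+s. ennreal (indicator {1..} s * (?n / s)) * H (s *\<^sub>R x) \<partial>lborel \<partial>lborel)"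
  proof (rule nn_integral_cong_AE)
    have "AE x in lborel. x \<noteq> (0::'a)" by (rule AE_lborel_singleton)
    then show "AE x in lborel. (\<integral>\<^sup>+r. ?w r x * H ((r / norm x) *\<^sub>R x) \<partial>lborel)
        = (\<integral>\<^sup>+s. ennreal (indicator {1..} s * (?n / s)) * H (s *\<^sub>R x) \<partial>lborel)"
    proof eventually_elim
      fix x :: 'a assume x: "x \<noteq> 0"
      have "(\<integral>\<^sup>+r. ?w r x * H ((r / norm x) *\<^sub>R x) \<partial>lborel)
          = ennreal \<bar>norm x\<bar> * (\<integral>\<^sup>+s. ?w (0 + norm x * s) x * H (((0 + norm x * s) / norm x) *\<^sub>R x) \<partial>lborel)"
        using x by (intro nn_integral_real_affine) (auto simp: indicator_def)
      also have "\<dots> = (\<integral>\<^sup>+s. ennreal (norm x) * (?w (norm x * s) x * H (s *\<^sub>R x)) \<partial>lborel)"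
        using x by (subst nn_integral_cmult) (auto simp: indicator_def)
      also have "\<dots> = (\<integral>\<^sup>+s. ennreal (indicator {1..} s * (?n / s)) * H (s *\<^sub>R x) \<partial>lborel)"
      proof (intro nn_integral_cong)
        fix s :: real
        have "ennreal (norm x) * ?w (norm x * s) x = ennreal (indicator {1..} s * (?n / s))"
          using x by (subst ennreal_mult[symmetric])
            (auto simp: indicator_def zero_less_mult_iff mult_le_cancel_left1 mult_le_cancel_left2)
        then show "ennreal (norm x) * (?w (norm x * s) x * H (s *\<^sub>R x))
            = ennreal (indicator {1..} s * (?n / s)) * H (s *\<^sub>R x)"
          by (simp add: mult.assoc[symmetric])
      qed
      finally show "(\<integral>\<^sup>+r. ?w r x * H ((r / norm x) *\<^sub>R x) \<partial>lborel)
          = (\<integral>\<^sup>+s. ennreal (indicator {1..} s * (?n / s)) * H (s *\<^sub>R x) \<partial>lborel)" .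
    qed
  qed
  also have "\<dots> = (\<integral>\<^sup>+s. \<integral>\<^sup>+x. ennreal (indicator {1..} s * (?n / s)) * H (s *\<^sub>R x) \<partial>lborel \<partial>lborel)"
    by (rule lborel_pair.Fubini'[symmetric]) measurable
  also have "\<dots> = (\<integral>\<^sup>+s. ennreal (?n * s powr (- ?n - 1)) * indicator {1..} s * (\<integral>\<^sup>+x. H x \<partial>lborel) \<partial>lborel)"
  proof (intro nn_integral_cong)
    fix s :: real
    show "(\<integral>\<^sup>+x. ennreal (indicator {1..} s * (?n / s)) * H (s *\<^sub>R x) \<partial>lborel)
        = ennreal (?n * s powr (- ?n - 1)) * indicator {1..} s * (\<integral>\<^sup>+x. H x \<partial>lborel)"
    proof (cases "1 \<le> s")
      case True
      have "ennreal (?n * s powr (- ?n - 1)) * (\<integral>\<^sup>+x. H x \<partial>lborel)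
          = ennreal (?n * s powr (- ?n - 1)) * ennreal (s ^ DIM('a)) * (\<integral>\<^sup>+x. H (s *\<^sub>R x) \<partial>lborel)"
        using True by (subst nn_integral_lborel_scaleR[of H s]) (auto simp: mult.assoc)
      also have "ennreal (?n * s powr (- ?n - 1)) * ennreal (s ^ DIM('a)) = ennreal (?n / s)"
        using True by (subst ennreal_mult[symmetric])
          (auto simp: powr_diff powr_minus powr_realpow field_simps)
      finally show ?thesis using True by (subst nn_integral_cmult) auto
    qed auto
  qed
  also have "\<dots> = (\<integral>\<^sup>+s. ennreal (?n * s powr (- ?n - 1)) * indicator {1..} s \<partial>lborel) * (\<integral>\<^sup>+x. H x \<partial>lborel)"
    by (subst nn_integral_multc) auto
  also have "(\<integral>\<^sup>+s. ennreal (?n * s powr (- ?n - 1)) * indicator {1..} s \<partial>lborel)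
      = 0 - (- (1 powr - ?n))"
  proof (rule nn_integral_FTC_atLeast)
    show "((\<lambda>s::real. - (s powr - ?n)) has_real_derivative ?n * s powr (- ?n - 1)) (at s)"
      if "1 \<le> s" for s
      using that by (auto intro!: derivative_eq_intros)
    show "((\<lambda>s::real. - (s powr - ?n)) \<longlongrightarrow> 0) at_top"
      using tendsto_minus[OF tendsto_neg_powr[of "- ?n" "\<lambda>s. s" at_top]] by (simp add: filterlim_ident)
  qed auto
  finally show ?thesis by simp
qed

lemma integral_sphere_measure:
  fixes H :: "'a::euclidean_space \<Rightarrow> real"
  assumes [measurable]: "H \<in> borel_measurable borel" and r: "r > 0"
  shows "(LINT x|sphere_measure r. H x)
    = (LINT x|lborel. (DIM('a) / r) * indicator (cball 0 r) x * H ((r / norm x) *\<^sub>R x))"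
proof -
  have [measurable]: "cball (0::'a) r \<in> sets borel" by simp
  have e: "(\<lambda>x::'a. ennreal (DIM('a) / r) * indicator (cball 0 r) x)
      = (\<lambda>x. ennreal (DIM('a) / r * indicator (cball 0 r) x))"
    by (auto simp: fun_eq_iff indicator_def)
  show ?thesis unfolding sphere_measure_def e
    using r by (subst integral_distr, simp, simp, subst integral_density) (auto simp: mult.assoc)
qed

text \<open>
  Stating polar coordinates as an equality of measures transfers them to integrals of real
  functions without splitting these into positive and negative parts.
\<close>

lemma lborel_eq_polar:
  "(lborel :: 'a::euclidean_space measure) = distr (density (lborel \<Otimes>\<^sub>M lborel)
     (\<lambda>(r, x). ennreal (indicator {0<..} r * (DIM('a) / r) * indicator {x. norm x \<le> r} x)))
     lborel (\<lambda>(r, x). (r / norm x) *\<^sub>R x)"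
proof (rule measure_eqI)
  fix A :: "'a set" assume "A \<in> sets lborel"
  then have [measurable]: "A \<in> sets borel" by simp
  let ?w = "\<lambda>(r, x::'a). ennreal (indicator {0<..} r * (DIM('a) / r) * indicator {x. norm x \<le> r} x)"
  let ?p = "\<lambda>(r, x::'a). (r / norm x) *\<^sub>R x"
  have "emeasure (distr (density (lborel \<Otimes>\<^sub>M lborel) ?w) lborel (\<lambda>(r, x). (r / norm x) *\<^sub>R x)) A
      = (\<integral>\<^sup>+y. indicator A y \<partial>distr (density (lborel \<Otimes>\<^sub>M lborel) ?w) lborel (\<lambda>(r, x). (r / norm x) *\<^sub>R x))"
    by (subst nn_integral_indicator) auto
  also have "\<dots> = (\<integral>\<^sup>+p. indicator A (?p p) \<partial>density (lborel \<Otimes>\<^sub>M lborel) ?w)"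
    by (rule nn_integral_distr) measurable
  also have "\<dots> = (\<integral>\<^sup>+p. ?w p * indicator A (?p p) \<partial>(lborel \<Otimes>\<^sub>M lborel))"
    by (rule nn_integral_density) measurable
  also have "\<dots> = (\<integral>\<^sup>+r. \<integral>\<^sup>+x. ?w (r, x) * indicator A (?p (r, x)) \<partial>lborel \<partial>lborel)"
    by (rule lborel.nn_integral_fst[symmetric]) measurable
  also have "\<dots> = emeasure lborel A"
    using nn_integral_polar[of "indicator A"] by simp
  finally show "emeasure lborel A
      = emeasure (distr (density (lborel \<Otimes>\<^sub>M lborel) ?w) lborel (\<lambda>(r, x). (r / norm x) *\<^sub>R x)) A"
    by simp
qed simp

lemma integral_polar:
  fixes H :: "'a::euclidean_space \<Rightarrow> real"
  assumes H: "integrable lborel H"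
  shows "integrable lborel (\<lambda>r. indicator {0<..} r * (LINT x|sphere_measure r. H x))"
    and "(LINT x|lborel. H x) = (LINT r|lborel. indicator {0<..} r * (LINT x|sphere_measure r. H x))"
proof -
  have Hm [measurable]: "H \<in> borel_measurable borel" using H by auto
  let ?w = "\<lambda>(r, x::'a). indicator {0<..} r * (DIM('a) / r) * indicator {x. norm x \<le> r} x :: real"
  let ?p = "\<lambda>(r, x::'a). (r / norm x) *\<^sub>R x"
  let ?N = "density (lborel \<Otimes>\<^sub>M lborel) (\<lambda>z. ennreal (?w z))"
  have N: "lborel = distr ?N lborel ?p"
    using lborel_eq_polar[where 'a='a] by (simp add: case_prod_beta')
  have w0: "AE z in lborel \<Otimes>\<^sub>M lborel. 0 \<le> ?w z"
    by (auto simp: indicator_def)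
  have pm: "?p \<in> measurable ?N lborel" by measurable
  have "integrable (distr ?N lborel ?p) H" using H N by simp
  then have "integrable ?N (\<lambda>z. H (?p z))" using integrable_distr_eq[OF pm, of H] by simp
  then have int: "integrable (lborel \<Otimes>\<^sub>M lborel) (\<lambda>z. ?w z *\<^sub>R H (?p z))"
    using w0 by (subst (asm) integrable_density) measurable
  have "(LINT x|lborel. H x) = (LINT z|?N. H (?p z))"
    using integral_distr[OF pm, of H] N by simp
  also have "\<dots> = (LINT z|(lborel \<Otimes>\<^sub>M lborel). ?w z *\<^sub>R H (?p z))"
    using w0 by (intro integral_density) measurable
  also have "\<dots> = (LINT r|lborel. LINT x|lborel. ?w (r, x) *\<^sub>R H (?p (r, x)))"
    by (rule lborel_pair.integral_fst'[OF int, symmetric])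
  finally have 1: "(LINT x|lborel. H x) = (LINT r|lborel. LINT x|lborel. ?w (r, x) *\<^sub>R H (?p (r, x)))" .
  have 2: "(\<lambda>r. LINT x|lborel. ?w (r, x) *\<^sub>R H (?p (r, x)))
      = (\<lambda>r. indicator {0<..} r * (LINT x|sphere_measure r. H x))"
  proof
    fix r :: real
    show "(LINT x|lborel. ?w (r, x) *\<^sub>R H (?p (r, x)))
      = indicator {0<..} r * (LINT x|sphere_measure r. H x)"
    proof (cases "r > 0")
      case True
      then show ?thesis
        by (auto simp: integral_sphere_measure indicator_def intro!: Bochner_Integration.integral_cong)
    qed simp
  qed
  show "integrable lborel (\<lambda>r. indicator {0<..} r * (LINT x|sphere_measure r. H x))"
    using lborel_pair.integrable_fst'[OF int] unfolding 2 .
  show "(LINT x|lborel. H x) = (LINT r|lborel. indicator {0<..} r * (LINT x|sphere_measure r. H x))"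
    using 1 unfolding 2 .
qed

section \<open>Fields with vanishing flux at infinity\<close>

text \<open>
  The remainder of the linear approximation lies between \<open>0\<close> and \<open>(y - t)\<^sup>2\<close>, so no separate
  limit is needed at \<open>0\<close>.
\<close>

lemma has_real_derivative_positive_part_squared:
  "((\<lambda>t. (max 0 t)\<^sup>2) has_real_derivative 2 * max 0 t) (at (t::real))"
  unfolding has_field_derivative_def has_derivative_at_alt
proof (intro conjI allI impI)
  fix e :: real assume e: "0 < e"
  have "norm ((max 0 y)\<^sup>2 - (max 0 t)\<^sup>2 - 2 * max 0 t * (y - t)) \<le> e * norm (y - t)"
    if "norm (y - t) < e" for y
  proof -
    have "(max 0 y)\<^sup>2 - (max 0 t)\<^sup>2 - 2 * max 0 t * (y - t)
        = (max 0 y - max 0 t)\<^sup>2 + 2 * max 0 t * (max 0 y - y)"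
      by (auto simp: max_def power2_eq_square algebra_simps)
    moreover have "0 \<le> 2 * max 0 t * (max 0 y - y)" by simp
    moreover have "(max 0 y - max 0 t)\<^sup>2 + 2 * max 0 t * (max 0 y - y) \<le> (y - t)\<^sup>2"
    proof (cases "0 \<le> y \<or> t \<le> 0")
      case True
      then have "2 * max 0 t * (max 0 y - y) = 0" by auto
      moreover have "\<bar>max 0 y - max 0 t\<bar> \<le> \<bar>y - t\<bar>" by auto
      ultimately show ?thesis unfolding abs_le_square_iff by linarith
    next
      case False
      then show ?thesis by (simp add: max_def power2_eq_square algebra_simps)
    qed
    ultimately have "norm ((max 0 y)\<^sup>2 - (max 0 t)\<^sup>2 - 2 * max 0 t * (y - t)) \<le> \<bar>y - t\<bar> * \<bar>y - t\<bar>"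
      by (simp add: power2_eq_square)
    also have "\<dots> \<le> e * norm (y - t)"
      using that unfolding real_norm_def by (intro mult_right_mono) auto
    finally show ?thesis .
  qed
  with e show "\<exists>d>0. \<forall>y. norm (y - t) < d \<longrightarrow>
      norm ((max 0 y)\<^sup>2 - (max 0 t)\<^sup>2 - 2 * max 0 t * (y - t)) \<le> e * norm (y - t)" by blast
qed (rule bounded_linear_mult_right)

text \<open>
  A continuously differentiable transition from \<open>0\<close> to \<open>1\<close> on the unit interval, and its
  derivative, the triangle of height \<open>2\<close>. Writing both through positive parts makes
  differentiability a consequence of the one function \<open>(max 0 t)\<^sup>2\<close>.
\<close>

definition tent :: "real \<Rightarrow> real" where
  "tent t = 4 * (max 0 t - 2 * max 0 (t - 1 / 2) + max 0 (t - 1))"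

definition smooth_step :: "real \<Rightarrow> real" where
  "smooth_step t = 2 * ((max 0 t)\<^sup>2 - 2 * (max 0 (t - 1 / 2))\<^sup>2 + (max 0 (t - 1))\<^sup>2)"

lemma tent_nonneg: "0 \<le> tent t" and tent_eq_0: "t \<le> 0 \<or> 1 \<le> t \<Longrightarrow> tent t = 0"
  by (auto simp: tent_def max_def)

lemma continuous_on_tent [continuous_intros]:
  "continuous_on S g \<Longrightarrow> continuous_on S (\<lambda>x. tent (g x))"
  unfolding tent_def by (intro continuous_intros)

lemma has_real_derivative_smooth_step: "(smooth_step has_real_derivative tent t) (at t)"
proof -
  have *: "((\<lambda>t. (max 0 (t - c))\<^sup>2) has_real_derivative 2 * max 0 (t - c)) (at t)" for c :: real
  proof -
    have "((\<lambda>t. t - c) has_real_derivative 1) (at t)" by (auto intro!: derivative_eq_intros)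
    from DERIV_chain2[OF has_real_derivative_positive_part_squared this] show ?thesis by simp
  qed
  show ?thesis
    unfolding smooth_step_def tent_def
    by (rule derivative_eq_intros has_real_derivative_positive_part_squared * refl | simp)+
qed

lemma smooth_step_eq_0: "t \<le> 0 \<Longrightarrow> smooth_step t = 0"
  by (simp add: smooth_step_def)

lemma smooth_step_eq_1: "1 \<le> t \<Longrightarrow> smooth_step t = 1"
  by (simp add: smooth_step_def power2_eq_square algebra_simps)

lemma smooth_step_bounds: "0 \<le> smooth_step t" "smooth_step t \<le> 1"
proof -
  have mono: "smooth_step u \<le> smooth_step v" if "u \<le> v" for u v
    by (rule DERIV_nonneg_imp_nondecreasing[OF that])
      (use has_real_derivative_smooth_step tent_nonneg in blast)
  show "0 \<le> smooth_step t" using mono[of "min t 0" t] smooth_step_eq_0[of "min t 0"] by simp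
  show "smooth_step t \<le> 1" using mono[of t "max t 1"] smooth_step_eq_1[of "max t 1"] by simp
qed

lemma continuous_on_smooth_step [continuous_intros]:
  "continuous_on S g \<Longrightarrow> continuous_on S (\<lambda>x. smooth_step (g x))"
  unfolding smooth_step_def by (intro continuous_intros)

text \<open>
  The integrand is \<open>G\<close> paired with minus the gradient of the cutoff
  \<open>1 - smooth_step (x \<bullet> x - R\<^sup>2)\<close>. In polar coordinates it becomes an average of the
  fluxes through the spheres of radius \<open>r\<close>, with weight \<open>2 * r * tent (r\<^sup>2 - R\<^sup>2)\<close>; this weight is the
  derivative of \<open>smooth_step (r\<^sup>2 - R\<^sup>2)\<close> and so has total mass \<open>1\<close>.
\<close>

lemma shell_flux_bound:
  fixes G :: "'a::euclidean_space \<Rightarrow> 'a"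
  assumes G: "continuous_on UNIV G" and R: "R > 0"
    and small: "\<And>r. r \<ge> R \<Longrightarrow> \<bar>LINT x|sphere_measure r. G x \<bullet> (x /\<^sub>R r)\<bar> \<le> e"
  shows "\<bar>LINT x|lborel. 2 * tent (x \<bullet> x - R\<^sup>2) * (G x \<bullet> x)\<bar> \<le> e"
proof -
  let ?H = "\<lambda>x. 2 * tent (x \<bullet> x - R\<^sup>2) * (G x \<bullet> x)"
  let ?flux = "\<lambda>r. LINT x|sphere_measure r. G x \<bullet> (x /\<^sub>R r)"
  let ?k = "\<lambda>r. 2 * r * tent (r\<^sup>2 - R\<^sup>2)"
  have Gm [measurable]: "G \<in> borel_measurable borel"
    using G by (rule borel_measurable_continuous_onI)
  have contH: "continuous_on UNIV ?H" by (intro continuous_intros G)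
  have outside: "tent (r\<^sup>2 - R\<^sup>2) = 0" if "r > 0" "r \<notin> {R..R + 1}" for r
  proof -
    have "r\<^sup>2 \<le> R\<^sup>2 \<or> r\<^sup>2 \<ge> (R + 1)\<^sup>2"
      using that R by (auto simp: not_le intro!: power_mono)
    then show ?thesis using R by (intro tent_eq_0) (auto simp: power2_eq_square algebra_simps)
  qed
  have H: "integrable lborel ?H"
  proof (rule integrable_continuous_compact_support[OF contH])
    fix x :: 'a assume "R + 2 \<le> norm x"
    then have "tent ((norm x)\<^sup>2 - R\<^sup>2) = 0" using R by (intro outside) auto
    then show "?H x = 0" by (simp add: power2_norm_eq_inner)
  qed
  have sphere: "(LINT x|sphere_measure r. ?H x) = ?k r * ?flux r" if r: "r > 0" for r
  proof -
    let ?p = "\<lambda>x::'a. (r / norm x) *\<^sub>R x"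
    \<comment> \<open>The radial projection maps \<open>0\<close> to \<open>0\<close>, where both sides vanish; no null set has to be removed.\<close>
    have homogeneous: "?H (?p x) = ?k r * (G (?p x) \<bullet> (?p x /\<^sub>R r))" for x
    proof (cases "x = 0")
      case False
      then have "?p x \<bullet> ?p x = r\<^sup>2" by (simp add: dot_square_norm power2_eq_square)
      moreover have "G (?p x) \<bullet> ?p x = r * (G (?p x) \<bullet> (?p x /\<^sub>R r))" using r by simp
      ultimately show ?thesis by (simp only: mult_ac)
    qed simp
    have "(LINT x|sphere_measure r. ?H x)
        = (LINT x|lborel. (DIM('a) / r) * indicator (cball 0 r) x * ?H (?p x))"
      using r borel_measurable_continuous_onI[OF contH] by (rule integral_sphere_measure[rotated])
    also have "\<dots> = (LINT x|lborel. ?k r *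
        ((DIM('a) / r) * indicator (cball 0 r) x * (G (?p x) \<bullet> (?p x /\<^sub>R r))))"
      unfolding homogeneous by (simp only: mult_ac)
    also have "\<dots> = ?k r *
        (LINT x|lborel. (DIM('a) / r) * indicator (cball 0 r) x * (G (?p x) \<bullet> (?p x /\<^sub>R r)))"
      by (rule Bochner_Integration.integral_mult_right_zero)
    also have "(LINT x|lborel. (DIM('a) / r) * indicator (cball 0 r) x * (G (?p x) \<bullet> (?p x /\<^sub>R r)))
        = ?flux r"
      using r by (intro integral_sphere_measure[symmetric]) measurable
    finally show ?thesis .
  qed
  have "((\<lambda>r. smooth_step (r\<^sup>2 - R\<^sup>2)) has_real_derivative ?k r) (at r)" for r
  proof -
    have "((\<lambda>r. r\<^sup>2 - R\<^sup>2) has_real_derivative 2 * r) (at r)"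
      by (auto intro!: derivative_eq_intros)
    from DERIV_chain2[OF has_real_derivative_smooth_step this] show ?thesis
      by (simp add: mult.commute)
  qed
  moreover have "isCont ?k r" for r
    by (rule continuous_on_interior[of UNIV]) (auto intro!: continuous_intros)
  ultimately have k: "has_bochner_integral lborel (\<lambda>r. ?k r * indicator {R..R + 1} r)
      (smooth_step ((R + 1)\<^sup>2 - R\<^sup>2) - smooth_step (R\<^sup>2 - R\<^sup>2))"
    using R by (intro has_bochner_integral_FTC_Icc_real) auto
  have "1 \<le> (R + 1)\<^sup>2 - R\<^sup>2" using R by (simp add: power2_eq_square algebra_simps)
  then have k: "has_bochner_integral lborel (\<lambda>r. ?k r * indicator {R..R + 1} r) 1"
    using k by (simp add: smooth_step_eq_0 smooth_step_eq_1)
  have "(LINT x|lborel. ?H x) = (LINT r|lborel. indicator {0<..} r * (LINT x|sphere_measure r. ?H x))"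
    by (rule integral_polar(2)[OF H])
  moreover have "\<bar>LINT r|lborel. indicator {0<..} r * (LINT x|sphere_measure r. ?H x)\<bar>
      \<le> (LINT r|lborel. e * (?k r * indicator {R..R + 1} r))"
  proof -
    have bound: "norm (indicator {0<..} r * (LINT x|sphere_measure r. ?H x))
        \<le> e * (?k r * indicator {R..R + 1} r)" for r
    proof (cases "r \<in> {R..R + 1}")
      case True
      then have r: "r > 0" using R by auto
      have "\<bar>?k r * ?flux r\<bar> \<le> ?k r * e"
        using small[of r] True tent_nonneg r unfolding abs_mult
        by (intro mult_mono) (auto intro!: mult_nonneg_nonneg)
      then show ?thesis using True r unfolding sphere[OF r] by (simp add: mult.commute)
    next
      case False
      then show ?thesis using outside[of r] sphere[of r] by (cases "r > 0") auto
    qed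
    have "norm (LINT r|lborel. indicator {0<..} r * (LINT x|sphere_measure r. ?H x))
        \<le> (LINT r|lborel. e * (?k r * indicator {R..R + 1} r))"
      by (rule Bochner_Integration.integral_norm_bound_integral[OF integral_polar(1)[OF H] _ bound])
        (use k in \<open>auto simp: has_bochner_integral_iff\<close>)
    then show ?thesis by simp
  qed
  moreover have "(LINT r|lborel. e * (?k r * indicator {R..R + 1} r)) = e"
    using k by (simp add: has_bochner_integral_iff)
  ultimately show ?thesis by (simp only:)
qed

text \<open>
  The cutoff \<open>\<psi>\<close> with value \<open>1\<close> on a large ball makes \<open>\<psi> G\<close> compactly supported, with divergence
  at most \<open>\<psi> h + \<nabla>\<psi> \<bullet> G\<close>. The integral of the second term is an average of fluxes through distant
  spheres, hence small, and that of the first tends to \<open>\<integral>h\<close> by dominated convergence. Averaging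
  over radii replaces the divergence theorem on balls by the one on cubes.
\<close>

lemma integral_nonneg_of_divergence_le_flux_vanishing:
  fixes G :: "'a::euclidean_space \<Rightarrow> 'a"
  assumes G: "\<And>x. (G has_derivative G' x) (at x)"
    and div: "\<And>x. (\<Sum>i\<in>Basis. G' x i \<bullet> i) \<le> h x"
    and h: "continuous_on UNIV h" and int: "integrable lborel h"
    and flux: "((\<lambda>r. LINT x|sphere_measure r. G x \<bullet> (x /\<^sub>R r)) \<longlongrightarrow> 0) at_top"
  shows "0 \<le> (LINT x|lborel. h x)"
proof -
  have contG: "continuous_on UNIV G"
    using G has_derivative_continuous by (metis continuous_at_imp_continuous_on)
  have hm [measurable]: "h \<in> borel_measurable borel" using int by auto
  define \<psi> where "\<psi> R x = 1 - smooth_step (x \<bullet> x - R\<^sup>2)" for R and x :: 'a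
  have cont\<psi>: "continuous_on UNIV (\<psi> R)" for R
    unfolding \<psi>_def by (intro continuous_intros)
  have \<psi>m [measurable]: "\<psi> R \<in> borel_measurable borel" for R
    using cont\<psi> by (rule borel_measurable_continuous_onI)
  have \<psi>01: "0 \<le> \<psi> R x" "\<psi> R x \<le> 1" for R x
    using smooth_step_bounds[of "x \<bullet> x - R\<^sup>2"] by (auto simp: \<psi>_def)
  have ge: "- e \<le> (LINT x|lborel. h x)" if e: "e > 0" for e
  proof -
    have "\<forall>\<^sub>F r in at_top. \<bar>LINT x|sphere_measure r. G x \<bullet> (x /\<^sub>R r)\<bar> < e"
      using tendstoD[OF flux e] by (simp add: dist_real_def)
    then obtain N where N: "\<And>r. r \<ge> N \<Longrightarrow> \<bar>LINT x|sphere_measure r. G x \<bullet> (x /\<^sub>R r)\<bar> < e"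
      unfolding eventually_at_top_linorder by blast
    define R0 where "R0 = max N 1"
    have *: "- e \<le> (LINT x|lborel. \<psi> R x * h x)" if R: "R \<ge> R0" for R
    proof -
      have R1: "R \<ge> 1" "R \<ge> N" using R by (auto simp: R0_def)
      let ?w = "\<lambda>x::'a. 2 * tent (x \<bullet> x - R\<^sup>2)"
      let ?hh = "\<lambda>x. \<psi> R x * h x - ?w x * (G x \<bullet> x)"
      have d\<psi>: "(\<psi> R has_derivative (\<lambda>v. - ?w x * (x \<bullet> v))) (at x)" for x
      proof -
        have "((\<lambda>y. y \<bullet> y - R\<^sup>2) has_derivative (\<lambda>v. 2 * (x \<bullet> v))) (at x)"
          by (auto intro!: derivative_eq_intros simp: inner_commute)
        from has_derivative_compose[OF this
            has_real_derivative_smooth_step[unfolded has_field_derivative_def]]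
        have "((\<lambda>y. smooth_step (y \<bullet> y - R\<^sup>2)) has_derivative (\<lambda>v. ?w x * (x \<bullet> v))) (at x)"
          by (simp add: mult.assoc mult.left_commute)
        then show ?thesis unfolding \<psi>_def by (auto intro!: derivative_eq_intros)
      qed
      have dF: "((\<lambda>x. \<psi> R x *\<^sub>R G x) has_derivative
          (\<lambda>v. \<psi> R x *\<^sub>R G' x v + (- ?w x * (x \<bullet> v)) *\<^sub>R G x)) (at x)" for x
        by (rule has_derivative_scaleR[OF d\<psi> G])
      have "(\<Sum>i\<in>Basis. (\<psi> R x *\<^sub>R G' x i + (- ?w x * (x \<bullet> i)) *\<^sub>R G x) \<bullet> i) \<le> ?hh x" for x
      proof -
        have "(\<Sum>i\<in>Basis. (\<psi> R x *\<^sub>R G' x i + (- ?w x * (x \<bullet> i)) *\<^sub>R G x) \<bullet> i)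
            = \<psi> R x * (\<Sum>i\<in>Basis. G' x i \<bullet> i) - ?w x * (\<Sum>i\<in>Basis. (G x \<bullet> i) * (x \<bullet> i))"
          unfolding sum_distrib_left sum_subtractf[symmetric]
          by (intro sum.cong refl) (simp add: inner_add_left algebra_simps)
        also have "(\<Sum>i\<in>Basis. (G x \<bullet> i) * (x \<bullet> i)) = G x \<bullet> x"
          by (rule euclidean_inner[symmetric])
        finally show ?thesis using mult_left_mono[OF div[of x] \<psi>01(1)[of R x]] by simp
      qed
      moreover have "continuous_on UNIV ?hh" by (intro continuous_intros cont\<psi> h contG)
      moreover have far: "\<psi> R x = 0" "tent (x \<bullet> x - R\<^sup>2) = 0" if "norm x \<ge> R + 1" for x
      proof -
        have "x \<bullet> x \<ge> (R + 1)\<^sup>2"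
          using that R1 by (simp add: dot_square_norm power_mono)
        then have "1 \<le> x \<bullet> x - R\<^sup>2" using R1 by (simp add: power2_eq_square algebra_simps)
        then show "\<psi> R x = 0" "tent (x \<bullet> x - R\<^sup>2) = 0"
          by (auto simp: \<psi>_def smooth_step_eq_1 tent_eq_0)
      qed
      ultimately have "0 \<le> (LINT x|lborel. ?hh x)"
        by (intro integral_nonneg_of_divergence_le[OF dF, of _ "R + 1"]) auto
      moreover have "integrable lborel (\<lambda>x. \<psi> R x * h x)"
        using \<psi>01 by (intro Bochner_Integration.integrable_bound[OF int])
          (auto simp: abs_mult mult_left_le_one_le)
      moreover have "integrable lborel (\<lambda>x. ?w x * (G x \<bullet> x))"
        by (rule integrable_continuous_compact_support[of _ "R + 1"])
          (auto intro!: continuous_intros contG simp: far)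
      moreover have "\<bar>LINT x|lborel. ?w x * (G x \<bullet> x)\<bar> \<le> e"
        using R1 N by (intro shell_flux_bound contG) (auto intro: less_imp_le)
      ultimately show ?thesis by (simp add: Bochner_Integration.integral_diff)
    qed
    have "(\<lambda>n. LINT x|lborel. \<psi> (R0 + real n) x * h x) \<longlonglongrightarrow> (LINT x|lborel. h x)"
    proof (rule integral_dominated_convergence[where w="\<lambda>x. norm (h x)"])
      show "AE x in lborel. (\<lambda>n. \<psi> (R0 + real n) x * h x) \<longlonglongrightarrow> h x"
      proof (rule AE_I2)
        fix x :: 'a
        obtain m :: nat where m: "norm x \<le> real m" using real_arch_simple by blast
        have "\<psi> (R0 + real n) x = 1" if "n \<ge> m" for n
        proof -
          have "norm x \<le> R0 + real n" using m that by (simp add: R0_def)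
          then have "x \<bullet> x \<le> (R0 + real n)\<^sup>2"
            unfolding dot_square_norm by (intro power_mono) auto
          then show ?thesis by (simp add: \<psi>_def smooth_step_eq_0)
        qed
        then have "\<forall>\<^sub>F n in sequentially. \<psi> (R0 + real n) x * h x = h x"
          unfolding eventually_sequentially by auto
        then show "(\<lambda>n. \<psi> (R0 + real n) x * h x) \<longlonglongrightarrow> h x"
          by (rule tendsto_eventually)
      qed
      show "AE x in lborel. norm (\<psi> (R0 + real n) x * h x) \<le> norm (h x)" for n
        using \<psi>01 by (auto simp: abs_mult mult_left_le_one_le)
    qed (use int in auto)
    then show ?thesis using * by (intro LIMSEQ_le_const) auto
  qed
  show ?thesis
  proof (rule field_le_epsilon)
    fix e :: real assume "0 < e"
    with ge[of e] show "0 \<le> (LINT x|lborel. h x) + e" by simp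
  qed
qed

section \<open>Stationary densities of the Fokker-Planck equation\<close>

lemma divergence_eq_sum_Basis:
  fixes F :: "real^'n \<Rightarrow> real^'n"
  assumes "(F has_derivative F') (at x)"
  shows "divergence F x = (\<Sum>i\<in>Basis. F' i \<bullet> i)"
proof -
  have F': "frechet_derivative F (at x) = F'"
    using frechet_derivative_at[OF assms] by simp
  have basis: "Basis = range (\<lambda>i::'n. axis i (1::real))" by (auto simp: Basis_vec_def)
  have inj: "inj (\<lambda>i::'n. axis i (1::real))" by (auto simp: inj_def axis_eq_axis)
  show ?thesis
    unfolding divergence_def F' basis sum.reindex[OF inj] o_def inner_axis by simp
qed

lemma has_derivative_gradient:
  fixes g :: "real^'n \<Rightarrow> real"
  assumes "g differentiable (at x)"
  shows "(g has_derivative (\<lambda>v. gradient g x \<bullet> v)) (at x)"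
proof -
  let ?D = "frechet_derivative g (at x)"
  have D: "(g has_derivative ?D) (at x)"
    using assms frechet_derivative_works by blast
  then have lin: "linear ?D" by (rule has_derivative_linear)
  have "?D v = gradient g x \<bullet> v" for v
  proof -
    have "?D v = ?D (\<Sum>i\<in>UNIV. v $ i *\<^sub>R axis i 1)"
      using basis_expansion[of v] by (simp add: scalar_mult_eq_scaleR)
    also have "\<dots> = (\<Sum>i\<in>UNIV. v $ i *\<^sub>R ?D (axis i 1))"
      by (simp add: linear_sum[OF lin] linear_scale[OF lin])
    also have "\<dots> = gradient g x \<bullet> v"
      by (simp add: gradient_def inner_vec_def mult.commute)
    finally show ?thesis .
  qed
  then have "?D = (\<lambda>v. gradient g x \<bullet> v)" by auto
  with D show ?thesis by simp
qed

text \<open>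
  With \<open>J = \<epsilon> D \<nabla>\<rho> - \<rho> f\<close>, this is \<open>\<epsilon> \<rho> D \<nabla>V - V J\<close>, the field whose flux through large
  spheres is assumed to vanish.
\<close>

definition green_field ::
  "(real^'n \<Rightarrow> real^'n) \<Rightarrow> real^'n^'n \<Rightarrow> real \<Rightarrow> (real^'n \<Rightarrow> real) \<Rightarrow> (real^'n \<Rightarrow> real) \<Rightarrow> real^'n \<Rightarrow> real^'n"
  where "green_field f D \<epsilon> \<rho> V x = (\<epsilon> * \<rho> x) *\<^sub>R (D *v gradient V x)
    - (\<epsilon> * V x) *\<^sub>R (D *v gradient \<rho> x) + (\<rho> x * V x) *\<^sub>R f x"

lemma symmetric_matrix_inner:
  fixes D :: "real^'n^'n"
  assumes "transpose D = D"
  shows "u \<bullet> (D *v v) = (D *v u) \<bullet> v"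
  by (metis assms dot_lmul_matrix transpose_matrix_vector)

text \<open>
  Green's identity in differential form. In the divergence of \<open>\<epsilon> \<rho> D \<nabla>V - V J\<close> the term
  \<open>V div J\<close> vanishes by the Fokker-Planck equation and the terms \<open>\<epsilon> \<nabla>\<rho> \<bullet> D \<nabla>V\<close> and
  \<open>\<epsilon> \<nabla>V \<bullet> D \<nabla>\<rho>\<close> cancel because \<open>D\<close> is symmetric. Keeping \<open>J\<close> as one field is essential: \<open>J\<close> is
  differentiable, whereas \<open>D \<nabla>\<rho>\<close> alone is not assumed to be.
\<close>

lemma divergence_green_field:
  fixes V \<rho> :: "real^'n \<Rightarrow> real"
  assumes D: "transpose D = D" and V: "twice_differentiable V"
    and FP: "stationary_fokker_planck f D \<epsilon> \<rho>"
  obtains G' where "\<And>x. (green_field f D \<epsilon> \<rho> V has_derivative G' x) (at x)"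
    and "\<And>x. (\<Sum>i\<in>Basis. G' x i \<bullet> i)
      = \<rho> x * (\<epsilon> * divergence (\<lambda>y. D *v gradient V y) x + f x \<bullet> gradient V x)"
proof -
  define J where "J = (\<lambda>x. \<epsilon> *\<^sub>R (D *v gradient \<rho> x) - \<rho> x *\<^sub>R f x)"
  have \<rho>: "\<rho> differentiable (at x)" and J: "J differentiable (at x)" and divJ: "divergence J x = 0"
    for x using FP by (auto simp: stationary_fokker_planck_def J_def Let_def)
  have dV: "(V has_derivative (\<lambda>v. gradient V x \<bullet> v)) (at x)" for x
    using V by (intro has_derivative_gradient) (auto simp: twice_differentiable_def)
  have dJ: "(J has_derivative frechet_derivative J (at x)) (at x)" for x
    using J frechet_derivative_works by blast
  let ?A = "\<lambda>x. frechet_derivative (\<lambda>y. D *v gradient V y) (at x)"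
  have dA: "((\<lambda>y. D *v gradient V y) has_derivative ?A x) (at x)" for x
  proof -
    have "gradient V differentiable (at x)" using V by (auto simp: twice_differentiable_def)
    then obtain B where "(gradient V has_derivative B) (at x)" unfolding differentiable_def by blast
    from bounded_linear.has_derivative[OF matrix_vector_mul_bounded_linear this]
    have "(\<lambda>y. D *v gradient V y) differentiable (at x)" unfolding differentiable_def by blast
    then show ?thesis using frechet_derivative_works by blast
  qed
  let ?G' = "\<lambda>x v. ((\<epsilon> * \<rho> x) *\<^sub>R ?A x v + (\<epsilon> * (gradient \<rho> x \<bullet> v)) *\<^sub>R (D *v gradient V x))
      - (V x *\<^sub>R frechet_derivative J (at x) v + (gradient V x \<bullet> v) *\<^sub>R J x)"
  have G: "green_field f D \<epsilon> \<rho> V = (\<lambda>x. (\<epsilon> * \<rho> x) *\<^sub>R (D *v gradient V x) - V x *\<^sub>R J x)"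
    by (auto simp: green_field_def J_def algebra_simps)
  have "(green_field f D \<epsilon> \<rho> V has_derivative ?G' x) (at x)" for x
    unfolding G
    by (intro has_derivative_diff has_derivative_scaleR dA dJ dV has_derivative_mult_right
        has_derivative_gradient \<rho>)
  moreover have "(\<Sum>i\<in>Basis. ?G' x i \<bullet> i)
      = \<rho> x * (\<epsilon> * divergence (\<lambda>y. D *v gradient V y) x + f x \<bullet> gradient V x)" for x
  proof -
    have inner: "(\<Sum>i\<in>Basis. (u \<bullet> i) * (v \<bullet> i)) = u \<bullet> v" for u v :: "real^'n"
      by (rule euclidean_inner[symmetric])
    have "(\<Sum>i\<in>Basis. ?G' x i \<bullet> i)
        = \<epsilon> * \<rho> x * (\<Sum>i\<in>Basis. ?A x i \<bullet> i)
          + \<epsilon> * (\<Sum>i\<in>Basis. (gradient \<rho> x \<bullet> i) * ((D *v gradient V x) \<bullet> i))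
          - V x * (\<Sum>i\<in>Basis. frechet_derivative J (at x) i \<bullet> i)
          - (\<Sum>i\<in>Basis. (gradient V x \<bullet> i) * (J x \<bullet> i))"
      unfolding sum_distrib_left sum_subtractf[symmetric] sum.distrib[symmetric]
      by (intro sum.cong refl) (simp add: inner_add_left inner_diff_left algebra_simps)
    also have "\<dots> = \<epsilon> * \<rho> x * divergence (\<lambda>y. D *v gradient V y) x
          + \<epsilon> * (gradient \<rho> x \<bullet> (D *v gradient V x)) - gradient V x \<bullet> J x"
      unfolding inner divergence_eq_sum_Basis[OF dA, symmetric]
        divergence_eq_sum_Basis[OF dJ, symmetric] divJ by simp
    also have "gradient V x \<bullet> J x
        = \<epsilon> * (gradient \<rho> x \<bullet> (D *v gradient V x)) - \<rho> x * (f x \<bullet> gradient V x)"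
      using symmetric_matrix_inner[OF D, of "gradient V x" "gradient \<rho> x"]
      by (simp add: J_def inner_diff_right inner_commute)
    finally show ?thesis by (simp add: algebra_simps)
  qed
  ultimately show ?thesis by (rule that[of ?G'])
qed

theorem proposition3:
  fixes f :: "real^'n \<Rightarrow> real^'n"
    and \<sigma> :: "real^'m^'n"
    and D :: "real^'n^'n"
    and \<epsilon> U L :: real
    and \<rho> \<phi> Vu Vl :: "real^'n \<Rightarrow> real"
    and M :: "'w measure"
    and W :: "real \<Rightarrow> 'w \<Rightarrow> real^'m"
    and X :: "real \<Rightarrow> 'w \<Rightarrow> real^'n"
  assumes eps: "\<epsilon> > 0"
    and f_poly: "polynomial_function f"
    and phi_poly: "real_polynomial_function \<phi>"
    and wiener: "standard_wiener M W"
    and sde: "solves_sde M f \<sigma> \<epsilon> W X"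
    and stationary: "\<forall>t\<ge>0. distributed M lborel (X t) (\<lambda>x. ennreal (\<rho> x))"
    and D: "D = \<sigma> ** transpose \<sigma>"
    and rho_nonneg: "\<forall>x. \<rho> x \<ge> 0"
    and rho_decay: "(\<rho> \<longlongrightarrow> 0) at_infinity"
    and rho_total: "has_bochner_integral lborel \<rho> 1"
    and fokker_planck: "stationary_fokker_planck f D \<epsilon> \<rho>"
    and expectation_exists: "integrable lborel (\<lambda>x. \<phi> x * \<rho> x)"
    and Vu_diff: "twice_differentiable Vu"
    and Vl_diff: "twice_differentiable Vl"
    and upper: "\<forall>x. \<epsilon> * divergence (\<lambda>y. D *v gradient Vu y) x + f x \<bullet> gradient Vu x + \<phi> x - U \<le> 0"
    and lower: "\<forall>x. \<epsilon> * divergence (\<lambda>y. D *v gradient Vl y) x + f x \<bullet> gradient Vl x + \<phi> x - L \<ge> 0"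
    and Vu_flux: "no_boundary_flux f D \<epsilon> \<rho> Vu"
    and Vl_flux: "no_boundary_flux f D \<epsilon> \<rho> Vl"
  shows "L \<le> stationary_expectation \<rho> \<phi> \<and> stationary_expectation \<rho> \<phi> \<le> U"
proof -
  have sym: "transpose D = D" unfolding D by (simp add: matrix_transpose_mul)
  have "\<forall>x. \<rho> differentiable (at x)"
    using fokker_planck by (auto simp: stationary_fokker_planck_def Let_def)
  then have cont\<rho>: "continuous_on UNIV \<rho>"
    by (auto simp: continuous_on_eq_continuous_at differentiable_imp_continuous_within)
  have cont\<phi>: "continuous_on UNIV \<phi>"
    using phi_poly continuous_on_polymonial_function by (auto simp: real_polynomial_function_eq)
  have int\<rho>: "integrable lborel \<rho>" "(LINT x|lborel. \<rho> x) = 1"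
    using rho_total by (auto simp: has_bochner_integral_iff)
  have expectation: "(LINT x|lborel. c * \<rho> x - \<phi> x * \<rho> x) = c - stationary_expectation \<rho> \<phi>" for c
    unfolding stationary_expectation_def
    using int\<rho> expectation_exists by (simp add: Bochner_Integration.integral_diff)
  have flux: "((\<lambda>r. LINT x|sphere_measure r. green_field f D \<epsilon> \<rho> V x \<bullet> (x /\<^sub>R r)) \<longlongrightarrow> 0) at_top"
    if "no_boundary_flux f D \<epsilon> \<rho> V" for V
    using that unfolding no_boundary_flux_def sphere_flux_def green_field_def .
  obtain Gu where Gu: "\<And>x. (green_field f D \<epsilon> \<rho> Vu has_derivative Gu x) (at x)"
    "\<And>x. (\<Sum>i\<in>Basis. Gu x i \<bullet> i)
      = \<rho> x * (\<epsilon> * divergence (\<lambda>y. D *v gradient Vu y) x + f x \<bullet> gradient Vu x)"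
    by (rule divergence_green_field[OF sym Vu_diff fokker_planck], rule that)
  obtain Gl where Gl: "\<And>x. (green_field f D \<epsilon> \<rho> Vl has_derivative Gl x) (at x)"
    "\<And>x. (\<Sum>i\<in>Basis. Gl x i \<bullet> i)
      = \<rho> x * (\<epsilon> * divergence (\<lambda>y. D *v gradient Vl y) x + f x \<bullet> gradient Vl x)"
    by (rule divergence_green_field[OF sym Vl_diff fokker_planck], rule that)
  \<comment> \<open>The auxiliary inequality, multiplied by \<open>\<rho> \<ge> 0\<close>, bounds the divergence of the flux field.\<close>
  have "0 \<le> (LINT x|lborel. U * \<rho> x - \<phi> x * \<rho> x)"
  proof (rule integral_nonneg_of_divergence_le_flux_vanishing[OF Gu(1) _ _ _ flux[OF Vu_flux]])
    fix x
    have bound: "\<epsilon> * divergence (\<lambda>y. D *v gradient Vu y) x + f x \<bullet> gradient Vu x \<le> U - \<phi> x"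
      using upper by (simp add: algebra_simps)
    show "(\<Sum>i\<in>Basis. Gu x i \<bullet> i) \<le> U * \<rho> x - \<phi> x * \<rho> x"
      unfolding Gu(2) using mult_left_mono[OF bound, of "\<rho> x"] rho_nonneg
      by (simp add: right_diff_distrib mult.commute)
  qed (auto intro!: continuous_intros cont\<rho> cont\<phi> int\<rho> expectation_exists)
  moreover have "0 \<le> (LINT x|lborel. - (L * \<rho> x - \<phi> x * \<rho> x))"
  proof (rule integral_nonneg_of_divergence_le_flux_vanishing[OF has_derivative_minus[OF Gl(1)]])
    fix x
    have bound: "L - \<phi> x \<le> \<epsilon> * divergence (\<lambda>y. D *v gradient Vl y) x + f x \<bullet> gradient Vl x"
      using lower by (simp add: algebra_simps)
    have "L * \<rho> x - \<phi> x * \<rho> x \<le> (\<Sum>i\<in>Basis. Gl x i \<bullet> i)"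
      unfolding Gl(2) using mult_left_mono[OF bound, of "\<rho> x"] rho_nonneg
      by (simp add: right_diff_distrib mult.commute)
    then show "(\<Sum>i\<in>Basis. - Gl x i \<bullet> i) \<le> - (L * \<rho> x - \<phi> x * \<rho> x)"
      by (simp add: sum_negf)
  next
    show "((\<lambda>r. LINT x|sphere_measure r. - green_field f D \<epsilon> \<rho> Vl x \<bullet> (x /\<^sub>R r)) \<longlongrightarrow> 0) at_top"
      using tendsto_minus[OF flux[OF Vl_flux]] by simp
  qed (auto intro!: continuous_intros cont\<rho> cont\<phi> int\<rho> expectation_exists)
  ultimately show ?thesis
    using expectation[of U] expectation[of L] unfolding Bochner_Integration.integral_minus by simp
qed

end
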